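(* Let $f(x,y):\mathbb{R}^m\times\mathbb{R}^{n_2}\to\mathbb{R}^m$ be a real-analytic function. Fix either $y=y_0$ (so that $x$ is the free variable) or $x=x_0$ (so that $y$ is the free variable). Then: 1. There is a finite set $E_{y_0}\subset\mathbb{R}$ (respectively $E_{x_0}\subset\mathbb{R}$) such that for any $\alpha\in\mathbb{R}\setminus E_{y_0}$ (respectively $\alpha\in\mathbb{R}\setminus E_{x_0}$), the Jacobian with respect to $x$ of $\alpha x+f(x,y)$ is full rank for all values of the free variable ($x\in\mathbb{R}^m$, respectively $y\in\mathbb{R}^{n_2}$) except for a set of Lebesgue measure zero. 2. Similarly, for any $\eta\in\mathbb{R}$ outside the finite set $1/E_{y_0}\cup\{0\}$ (respectively $1/E_{x_0}\cup\{0\}$), the Jacobian with respect to $x$ of $x+\eta f(x,y)$ is full rank for all values of the free variable except for a set of Lebesgue measure zero.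
   Context: For a finite set $E\subset\mathbb{R}$, $1/E=\{1/\alpha:\alpha\in E,\ \alpha\ne0\}$. *)

theory Defs
  imports "HOL-Analysis.Analysis"
begin

text \<open>A multi-index is a function supported on the standard basis; requiring the value
  0 off the basis makes the representation unique.\<close>

definition multi_indices :: "('a::euclidean_space \<Rightarrow> nat) set" where
  "multi_indices = {k. \<forall>b. b \<notin> Basis \<longrightarrow> k b = 0}"

definition monomial_val :: "('a::euclidean_space \<Rightarrow> nat) \<Rightarrow> 'a \<Rightarrow> real" where
  "monomial_val k h = (\<Prod>b\<in>Basis. (h \<bullet> b) ^ k b)"

text \<open>Unconditional summation over the multi-indices is, in finite dimension, absolute
  convergence of the power series.\<close>

definition real_analytic_at :: "('a::euclidean_space \<Rightarrow> 'b::euclidean_space) \<Rightarrow> 'a \<Rightarrow> bool" where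
  "real_analytic_at f p \<longleftrightarrow>
    (\<exists>c. \<exists>r>0. \<forall>h. norm h < r \<longrightarrow>
      ((\<lambda>k. monomial_val k h *\<^sub>R c k) has_sum f (p + h)) multi_indices)"

definition real_analytic :: "('a::euclidean_space \<Rightarrow> 'b::euclidean_space) \<Rightarrow> bool" where
  "real_analytic f \<longleftrightarrow> (\<forall>p. real_analytic_at f p)"

definition reciprocals :: "real set \<Rightarrow> real set" where
  "reciprocals E = {1 / \<alpha> | \<alpha>. \<alpha> \<in> E \<and> \<alpha> \<noteq> 0}"

definition full_rank :: "real ^ 'n ^ 'm \<Rightarrow> bool" where
  "full_rank A \<longleftrightarrow> rank A = min CARD('n) CARD('m)"

end

theory Submission
  imports Defs "HOL-Complex_Analysis.Conformal_Mappings"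
begin

text \<open>
  Fix \<open>p\<close> and let \<open>E\<close> be the set of roots of the monic polynomial \<open>det (\<alpha> I + J p)\<close> in \<open>\<alpha>\<close>,
  where \<open>J\<close> is the Jacobian of \<open>f\<close> in the first variable. For \<open>\<alpha>\<close> outside \<open>E\<close> the function
  \<open>g z = det (\<alpha> I + J z)\<close> does not vanish at \<open>p\<close>, and its restriction to every line extends
  locally to a holomorphic function. Hence the zero set \<open>Z\<close> of \<open>g\<close> meets every line through
  \<open>p\<close> in a countable set. By Fubini applied to the pairs \<open>(t, v)\<close> with \<open>p + t v \<in> Z\<close>, for
  almost every \<open>t\<close> the set \<open>(Z - p) / t\<close> is null, and so is \<open>Z\<close>. The second part follows by
  scaling with \<open>\<alpha> = 1 / \<eta>\<close>.
\<close>

subsection \<open>Holomorphic extension of functions of a real variable\<close>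

text \<open>This is real analyticity on the line, encoded by local complex extensions so that
  closure properties and the identity theorem come from complex analysis.\<close>

definition locally_holomorphic :: "(real \<Rightarrow> real) \<Rightarrow> bool" where
  "locally_holomorphic h \<longleftrightarrow> (\<forall>t\<^sub>0. \<exists>r>0. \<exists>H. H holomorphic_on ball (complex_of_real t\<^sub>0) r \<and>
     (\<forall>t. \<bar>t - t\<^sub>0\<bar> < r \<longrightarrow> H (complex_of_real t) = complex_of_real (h t)))"

lemma locally_holomorphic_const: "locally_holomorphic (\<lambda>t. c)"
  unfolding locally_holomorphic_def
  by (intro allI exI[of _ 1] conjI exI[of _ "\<lambda>_. complex_of_real c"]) auto

text \<open>Extensions of the operands are combined on the smaller of their two discs.
  \<open>F\<close> is the complex form of the real operation \<open>G\<close>, so sums and products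
  are handled at once.\<close>

lemma locally_holomorphic_binop:
  assumes "locally_holomorphic f" "locally_holomorphic g"
    and real: "\<And>a b. F (complex_of_real a) (complex_of_real b) = complex_of_real (G a b)"
    and hol: "\<And>H K S. H holomorphic_on S \<Longrightarrow> K holomorphic_on S \<Longrightarrow> (\<lambda>z. F (H z) (K z)) holomorphic_on S"
  shows "locally_holomorphic (\<lambda>t. G (f t) (g t))"
  unfolding locally_holomorphic_def
proof
  fix t\<^sub>0
  obtain r H where H: "r > 0" "H holomorphic_on ball (complex_of_real t\<^sub>0) r"
      "\<And>t. \<bar>t - t\<^sub>0\<bar> < r \<Longrightarrow> H (complex_of_real t) = complex_of_real (f t)"
    using assms(1) unfolding locally_holomorphic_def by metis
  obtain s K where K: "s > 0" "K holomorphic_on ball (complex_of_real t\<^sub>0) s"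
      "\<And>t. \<bar>t - t\<^sub>0\<bar> < s \<Longrightarrow> K (complex_of_real t) = complex_of_real (g t)"
    using assms(2) unfolding locally_holomorphic_def by metis
  have "H holomorphic_on ball (complex_of_real t\<^sub>0) (min r s)"
       "K holomorphic_on ball (complex_of_real t\<^sub>0) (min r s)"
    by (rule holomorphic_on_subset[OF H(2)], force) (rule holomorphic_on_subset[OF K(2)], force)
  then have "(\<lambda>z. F (H z) (K z)) holomorphic_on ball (complex_of_real t\<^sub>0) (min r s)"
    by (rule hol)
  with H K show "\<exists>r>0. \<exists>H. H holomorphic_on ball (complex_of_real t\<^sub>0) r \<and>
     (\<forall>t. \<bar>t - t\<^sub>0\<bar> < r \<longrightarrow> H (complex_of_real t) = complex_of_real (G (f t) (g t)))"
    by (intro exI[of _ "min r s"] conjI exI[of _ "\<lambda>z. F (H z) (K z)"]) (auto simp: real)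
qed

lemma locally_holomorphic_add:
  "locally_holomorphic f \<Longrightarrow> locally_holomorphic g \<Longrightarrow> locally_holomorphic (\<lambda>t. f t + g t)"
  by (rule locally_holomorphic_binop[where F = "(+)"]) (auto intro: holomorphic_intros)

lemma locally_holomorphic_mult:
  "locally_holomorphic f \<Longrightarrow> locally_holomorphic g \<Longrightarrow> locally_holomorphic (\<lambda>t. f t * g t)"
  by (rule locally_holomorphic_binop[where F = "(*)"]) (auto intro: holomorphic_intros)

lemma locally_holomorphic_sum:
  "(\<And>i. i \<in> I \<Longrightarrow> locally_holomorphic (f i)) \<Longrightarrow> locally_holomorphic (\<lambda>t. \<Sum>i\<in>I. f i t)"
  by (induction I rule: infinite_finite_induct) (auto intro: locally_holomorphic_const locally_holomorphic_add)

lemma locally_holomorphic_prod: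
  "(\<And>i. i \<in> I \<Longrightarrow> locally_holomorphic (f i)) \<Longrightarrow> locally_holomorphic (\<lambda>t. \<Prod>i\<in>I. f i t)"
  by (induction I rule: infinite_finite_induct) (auto intro: locally_holomorphic_const locally_holomorphic_mult)

lemma locally_holomorphic_det:
  fixes A :: "real \<Rightarrow> real ^ 'n ^ 'n"
  assumes "\<And>i j. locally_holomorphic (\<lambda>t. A t $ i $ j)"
  shows "locally_holomorphic (\<lambda>t. det (A t))"
  unfolding det_def
  by (intro locally_holomorphic_sum locally_holomorphic_mult locally_holomorphic_prod locally_holomorphic_const assms)

text \<open>Identity theorem: accumulating real zeros of \<open>h\<close> are accumulating zeros of
  its extension, which therefore vanishes on the whole disc.\<close>

lemma locally_holomorphic_zero_near_limpt:
  assumes "locally_holomorphic h" "t\<^sub>0 islimpt {t. h t = 0}"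
  shows "\<forall>\<^sub>F t in nhds t\<^sub>0. h t = 0"
proof -
  obtain r H where H: "r > 0" "H holomorphic_on ball (complex_of_real t\<^sub>0) r"
      "\<And>t. \<bar>t - t\<^sub>0\<bar> < r \<Longrightarrow> H (complex_of_real t) = complex_of_real (h t)"
    using assms(1) unfolding locally_holomorphic_def by metis
  let ?U = "{t. h t = 0} \<inter> ball t\<^sub>0 r"
  have "\<forall>\<^sub>F t in at t\<^sub>0. t \<in> ball t\<^sub>0 r"
    by (intro eventually_at_in_open') (use H(1) in auto)
  with assms(2) have "t\<^sub>0 islimpt ?U"
    by (rule islimpt_Int_eventually)
  then have lim: "complex_of_real t\<^sub>0 islimpt complex_of_real ` ?U"
    by (intro islimpt_isCont_image) (auto simp: eventually_at_filter)
  have "H (complex_of_real t) = 0" if "\<bar>t - t\<^sub>0\<bar> < r" for t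
  proof (rule analytic_continuation[OF H(2) _ _ _ _ lim])
    show "complex_of_real ` ?U \<subseteq> ball (complex_of_real t\<^sub>0) r"
      by auto
    show "H z = 0" if "z \<in> complex_of_real ` ?U" for z
      using that H(3) by (auto simp: dist_real_def abs_minus_commute)
    show "complex_of_real t \<in> ball (complex_of_real t\<^sub>0) r"
      using that by (simp add: dist_real_def abs_minus_commute)
  qed (use H(1) in auto)
  with H(3) have "h t = 0" if "\<bar>t - t\<^sub>0\<bar> < r" for t
    using that by simp
  then show ?thesis
    using H(1) by (auto simp: eventually_nhds_metric dist_real_def)
qed

text \<open>By connectedness of the line, the clopen set \<open>?A\<close> of points near which
  \<open>h\<close> vanishes is empty, since it misses \<open>a\<close>. Hence the zeros accumulate
  nowhere, and such a set is countable.\<close>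

lemma locally_holomorphic_countable_zeros:
  assumes h: "locally_holomorphic h" and "h a \<noteq> 0"
  shows "countable {t. h t = 0}"
proof -
  let ?Z = "{t. h t = 0}" and ?A = "{t. \<forall>\<^sub>F s in nhds t. h s = 0}"
  have "open ?A"
    unfolding open_subopen[of ?A] by (force simp: eventually_nhds)
  moreover have "closed ?A"
    unfolding closed_limpt
  proof safe
    fix t assume "t islimpt ?A"
    then have "t islimpt ?Z"
      by (rule islimpt_subset) (auto dest: eventually_nhds_x_imp_x)
    then show "\<forall>\<^sub>F s in nhds t. h s = 0"
      by (rule locally_holomorphic_zero_near_limpt[OF h])
  qed
  ultimately have "?A = {} \<or> ?A = UNIV"
    using clopen[of ?A] by blast
  moreover have "a \<notin> ?A"
    using assms(2) by (auto dest: eventually_nhds_x_imp_x)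
  ultimately have "\<not> t islimpt ?Z" for t
    using locally_holomorphic_zero_near_limpt[OF h, of t] by auto
  then have "?Z sparse_in UNIV"
    by (simp add: sparse_in_eventually_iff islimpt_iff_eventually)
  from sparse_imp_countable[OF open_UNIV this] show ?thesis by simp
qed

subsection \<open>Null sets and determinants\<close>

text \<open>Swapping the almost-everywhere quantifiers over \<open>t\<close> and \<open>v\<close>
  yields one nonzero \<open>t\<close> whose slice in \<open>v\<close> is null, and \<open>Z\<close>
  is an affine image of that slice. The case \<open>v = 0\<close> of the hypothesis forces
  \<open>p\<close> to lie outside \<open>Z\<close>.\<close>

lemma null_sets_if_null_on_lines:
  fixes Z :: "'a::euclidean_space set"
  assumes Z: "Z \<in> sets borel"
    and null: "\<And>v. {t. p + t *\<^sub>R v \<in> Z} \<in> null_sets lborel"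
  shows "Z \<in> null_sets lebesgue"
proof -
  have meas: "{x \<in> space (lborel \<Otimes>\<^sub>M lborel). p + fst x *\<^sub>R snd x \<notin> Z} \<in> sets (lborel \<Otimes>\<^sub>M (lborel :: 'a measure))"
    using Z by measurable
  have "AE v in (lborel :: 'a measure). AE t in lborel. p + t *\<^sub>R v \<notin> Z"
  proof (rule AE_I2)
    fix v :: 'a
    show "AE t in lborel. p + t *\<^sub>R v \<notin> Z"
      using AE_not_in[OF null[of v]] by simp
  qed
  then have "AE t in lborel. AE v in (lborel :: 'a measure). p + t *\<^sub>R v \<notin> Z"
    using lborel_pair.AE_commute[of "\<lambda>t v. p + t *\<^sub>R v \<notin> Z"] meas by simp
  \<comment> \<open>At \<open>t = 0\<close> the slice is empty or everything and cannot be rescaled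
    to recover \<open>Z\<close>.\<close>
  moreover have "AE t in lborel. t \<noteq> (0::real)"
    using AE_lborel_singleton[of 0] by simp
  ultimately have "AE t in lborel. t \<noteq> 0 \<and> (AE v in (lborel :: 'a measure). p + t *\<^sub>R v \<notin> Z)"
    by eventually_elim auto
  \<comment> \<open>Lebesgue measure on the line is not zero, so a property holding almost
    everywhere holds somewhere.\<close>
  then have "\<exists>t::real. t \<noteq> 0 \<and> (AE v in (lborel :: 'a measure). p + t *\<^sub>R v \<notin> Z)"
    by (intro eventually_happens'[of "ae_filter lborel"]) (simp_all add: ae_filter_eq_bot_iff)
  then obtain t where t: "t \<noteq> 0" "AE v in (lborel :: 'a measure). p + t *\<^sub>R v \<notin> Z"
    by blast
  let ?W = "{v. p + t *\<^sub>R v \<in> Z}"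
  have "?W \<in> null_sets lborel"
    using AE_iff_null_sets[of ?W lborel] Z t(2) by simp
  then have "negligible ?W"
    by (simp add: negligible_iff_null_sets null_sets_completionI)
  then have "negligible ((\<lambda>v. p + t *\<^sub>R v) ` ?W)"
    by (intro negligible_differentiable_image_negligible order_refl derivative_intros)
  moreover have "Z \<subseteq> (\<lambda>v. p + t *\<^sub>R v) ` ?W"
  proof
    fix z assume "z \<in> Z"
    with t(1) have "z = p + t *\<^sub>R ((z - p) /\<^sub>R t)" "(z - p) /\<^sub>R t \<in> ?W" by auto
    then show "z \<in> (\<lambda>v. p + t *\<^sub>R v) ` ?W" by blast
  qed
  ultimately show ?thesis
    using negligible_subset negligible_iff_null_sets by blast
qed

lemma full_rank_iff_det: "full_rank A \<longleftrightarrow> det A \<noteq> 0" for A :: "real ^ 'n ^ 'n"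
  by (simp add: full_rank_def full_rank_injective flip: invertible_det_nz)
     (simp add: invertible_left_inverse matrix_left_invertible_injective)

lemma full_rank_scaleR:
  fixes A :: "real ^ 'n ^ 'n"
  assumes "c \<noteq> 0"
  shows "full_rank (c *\<^sub>R A) \<longleftrightarrow> full_rank A"
proof -
  have "invertible (c *\<^sub>R A) \<longleftrightarrow> invertible A"
    using scalar_invertible[of c A] scalar_invertible[of "inverse c" "c *\<^sub>R A"] assms by auto
  then show ?thesis
    by (simp add: full_rank_iff_det flip: invertible_det_nz)
qed

text \<open>The determinant is a polynomial in \<alpha>. It is not the zero polynomial because its
  rescaling \<open>det (mat 1 + e *\<^sub>R A)\<close> tends to 1 as \<open>e\<close> tends to
  0.\<close>

lemma finite_det_mat_add_eq_0:
  fixes A :: "real ^ 'n ^ 'n"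
  shows "finite {\<alpha>. det (mat \<alpha> + A) = 0}"
proof -
  \<comment> \<open>The determinant is taken over the polynomial ring, with \<open>[:0, 1:]\<close>
    standing for the indeterminate; evaluation commutes with the Leibniz sum.\<close>
  define P where "P = det (\<chi> i j. (if i = j then [:0, 1:] else 0) + [:A $ i $ j:])"
  have P: "poly P \<alpha> = det (mat \<alpha> + A)" for \<alpha>
    unfolding P_def det_def
    by (simp add: poly_sum poly_prod of_int_poly mat_def if_distrib[of "\<lambda>p. poly p \<alpha>"] cong: if_cong)
  have "P \<noteq> 0"
  proof
    assume "P = 0"
    then have z: "det (mat \<alpha> + A) = 0" for \<alpha> using P[of \<alpha>] by simp
    have "det (mat 1 + e *\<^sub>R A) = 0" if "e \<noteq> 0" for e
    proof -
      have "\<not> full_rank (mat (1/e) + A)"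
        using z by (simp add: full_rank_iff_det)
      moreover have "mat 1 + e *\<^sub>R A = e *\<^sub>R (mat (1/e) + A)"
        using that by (vector mat_def field_simps)
      ultimately show ?thesis
        using that by (metis full_rank_iff_det full_rank_scaleR)
    qed
    then have "((\<lambda>e. det (mat 1 + e *\<^sub>R A)) \<longlongrightarrow> 0) (at 0)"
      by (intro tendsto_eventually) (auto simp: eventually_at_filter)
    moreover have "((\<lambda>e. det (mat 1 + e *\<^sub>R A)) \<longlongrightarrow> det (mat 1 + 0 *\<^sub>R A)) (at 0)"
      unfolding det_def by (simp, intro tendsto_intros) (auto intro!: tendsto_eq_intros)
    ultimately have "det (mat 1 + 0 *\<^sub>R A) = 0"
      by (metis at_neq_bot tendsto_unique)
    then show False by simp
  qed
  then show ?thesis using poly_roots_finite[of P] by (simp add: P)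
qed

subsection \<open>Multivariate power series\<close>

text \<open>At the diagonal point with all coordinates \<rho>, each monomial equals \<rho> to its
  total degree, and unconditional convergence of a real series is absolute.\<close>

lemma power_series_abs_summable:
  fixes a :: "('a::euclidean_space \<Rightarrow> nat) \<Rightarrow> real" and r :: real
  assumes "r > 0" and sum: "\<And>h. norm h < r \<Longrightarrow> ((\<lambda>k. monomial_val k h * a k) has_sum g h) multi_indices"
  obtains \<rho> :: real where "\<rho> > 0" "\<rho> * DIM('a) < r"
    "(\<lambda>k. \<bar>a k\<bar> * \<rho> ^ (\<Sum>b\<in>Basis. k b)) summable_on multi_indices"
proof -
  \<comment> \<open>The diagonal point then has norm at most \<open>r / 2\<close>, strictly inside
    the domain of convergence.\<close>
  define \<rho> where "\<rho> = r / (2 * DIM('a))"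
  have \<rho>: "\<rho> > 0" "\<rho> * DIM('a) < r" using \<open>r > 0\<close> by (auto simp: \<rho>_def field_simps)
  define h where "h = (\<Sum>b\<in>Basis. \<rho> *\<^sub>R (b::'a))"
  have "norm h \<le> \<rho> * DIM('a)"
    unfolding h_def using \<rho>(1) by (intro order_trans[OF norm_sum]) (simp add: mult.commute)
  with \<rho> have "((\<lambda>k. monomial_val k h * a k) has_sum g h) multi_indices"
    by (intro sum) simp
  then have "(\<lambda>k. \<bar>monomial_val k h * a k\<bar>) summable_on multi_indices"
    using summable_on_iff_abs_summable_on_real[of "\<lambda>k. monomial_val k h * a k"]
    by (auto simp: summable_on_def)
  moreover have "h \<bullet> b = \<rho>" if "b \<in> Basis" for b
    using that by (simp add: h_def inner_sum_left inner_Basis if_distrib cong: if_cong)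
  then have "monomial_val k h = \<rho> ^ (\<Sum>b\<in>Basis. k b)" for k
    unfolding monomial_val_def by (simp add: power_sum)
  ultimately show ?thesis using that \<rho> by (simp add: abs_mult mult.commute)
qed

text \<open>A bound on the degree bounds each exponent on the basis; finiteness also relies on the
  convention that multi-indices vanish off the basis.\<close>

lemma finite_multi_indices_le: "finite {k \<in> multi_indices. (\<Sum>b\<in>Basis. k b) \<le> N}"
  for N :: nat
proof (rule finite_subset)
  have "k b \<le> N" if "(\<Sum>b\<in>Basis. k b) \<le> N" "b \<in> Basis" for k :: "'a \<Rightarrow> nat" and b
    using member_le_sum[of b Basis k] that by simp
  then show "{k \<in> multi_indices. (\<Sum>b\<in>Basis. k b) \<le> N} \<subseteq>
      {k. \<forall>b::'a. (b \<in> Basis \<longrightarrow> k b \<in> {..N}) \<and> (b \<notin> Basis \<longrightarrow> k b = 0)}"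
    unfolding multi_indices_def by blast
qed (intro finite_set_of_finite_funs; simp)

lemma abs_monomial_val_le:
  assumes "\<And>b. b \<in> Basis \<Longrightarrow> \<bar>h \<bullet> b\<bar> \<le> s"
  shows "\<bar>monomial_val k h\<bar> \<le> s ^ (\<Sum>b\<in>Basis. k b)"
  unfolding monomial_val_def power_sum abs_prod power_abs
  by (intro prod_mono conjI power_mono assms) auto

lemma monomial_val_differentiable: "monomial_val k differentiable at x"
proof -
  have "((\<lambda>h. (h \<bullet> b) ^ k b) has_derivative frechet_derivative (\<lambda>h. (h \<bullet> b) ^ k b) (at x)) (at x)" for b
    by (subst frechet_derivative_works[symmetric]) simp
  then show ?thesis
    unfolding monomial_val_def[abs_def] differentiable_def by (intro exI, rule has_derivative_prod)
qed

text \<open>Treating the centre is enough, since an analytic function is expanded afresh at every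
  point.\<close>

lemma power_series_differentiable:
  fixes a :: "('a::euclidean_space \<Rightarrow> nat) \<Rightarrow> real" and r :: real
  assumes "r > 0" and sum: "\<And>h. norm h < r \<Longrightarrow> ((\<lambda>k. monomial_val k h * a k) has_sum g h) multi_indices"
  shows "g differentiable at 0"
proof -
  obtain \<rho> :: real where \<rho>: "\<rho> > 0" "\<rho> * DIM('a) < r"
    and summ: "(\<lambda>k. \<bar>a k\<bar> * \<rho> ^ (\<Sum>b\<in>Basis. k b)) summable_on multi_indices"
    by (rule power_series_abs_summable[OF assms])
  have "\<rho> \<le> \<rho> * DIM('a)" using \<rho>(1) DIM_positive[where 'a='a] by (simp add: Suc_leI)
  with \<rho>(2) have \<rho>r: "\<rho> < r" by linarith
  let ?deg = "\<lambda>k. \<Sum>b\<in>Basis. k (b::'a)"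
  \<comment> \<open>Beyond the finitely many terms of degree at most 1 the series is \<open>O(\<parallel>h\<parallel>\<^sup>2)\<close>.\<close>
  define K :: "('a \<Rightarrow> nat) set" where "K = {k \<in> multi_indices. ?deg k \<le> 1}"
  have K: "finite K" "K \<subseteq> multi_indices" unfolding K_def by (rule finite_multi_indices_le) auto
  define P where "P h = (\<Sum>k\<in>K. monomial_val k h * a k)" for h
  define M where "M = (\<Sum>\<^sub>\<infinity>k\<in>multi_indices - K. \<bar>a k\<bar> * \<rho> ^ ?deg k)"
  have M: "((\<lambda>k. \<bar>a k\<bar> * \<rho> ^ ?deg k) has_sum M) (multi_indices - K)"
    unfolding M_def using summ by (intro has_sum_infsum summable_on_subset_banach[OF summ]) auto
  have rem: "\<bar>g h - P h\<bar> \<le> (norm h / \<rho>)\<^sup>2 * M" if h: "norm h \<le> \<rho>" for h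
  proof -
    have "((\<lambda>k. monomial_val k h * a k) has_sum (g h - P h)) (multi_indices - K)"
      unfolding P_def using K h \<rho>r by (intro has_sum_Diff sum has_sum_finite) auto
    moreover have "norm (monomial_val k h * a k) \<le> (norm h / \<rho>)\<^sup>2 * (\<bar>a k\<bar> * \<rho> ^ ?deg k)"
      if "k \<in> multi_indices - K" for k
    proof -
      \<comment> \<open>Outside \<open>K\<close> the degree is at least 2, so the truncated
        subtraction is exact.\<close>
      have d: "?deg k = 2 + (?deg k - 2)" using that by (auto simp: K_def)
      have "\<bar>monomial_val k h\<bar> \<le> norm h ^ ?deg k"
        by (rule abs_monomial_val_le) (rule Basis_le_norm)
      also have "\<dots> = (norm h)\<^sup>2 * norm h ^ (?deg k - 2)"
        by (subst d) (simp only: power_add)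
      also have "\<dots> \<le> (norm h)\<^sup>2 * \<rho> ^ (?deg k - 2)"
        using h by (intro mult_left_mono power_mono) auto
      also have "\<dots> = (norm h / \<rho>)\<^sup>2 * \<rho> ^ ?deg k"
        using \<rho>(1) by (subst (2) d) (simp add: power_add power_divide power2_eq_square)
      finally have "\<bar>monomial_val k h\<bar> * \<bar>a k\<bar> \<le> (norm h / \<rho>)\<^sup>2 * \<rho> ^ ?deg k * \<bar>a k\<bar>"
        by (rule mult_right_mono) simp
      then show ?thesis by (simp add: abs_mult mult_ac)
    qed
    ultimately have "norm (g h - P h) \<le> (norm h / \<rho>)\<^sup>2 * M"
      by (rule norm_infsum_le[OF _ has_sum_cmult_right[OF M]])
    then show ?thesis by simp
  qed
  have "P differentiable at 0"
    unfolding P_def using K(1)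
    by (intro differentiable_sum ballI differentiable_mult monomial_val_differentiable) auto
  moreover have "((\<lambda>h. g h - P h) has_derivative (\<lambda>_. 0)) (at 0)"
  proof (rule has_derivativeI_sandwich[OF \<rho>(1)])
    have z: "g 0 - P 0 = 0" using rem[of 0] \<rho>(1) by simp
    show "norm (g h - P h - (g 0 - P 0) - 0) / norm (h - 0) \<le> norm h * M / \<rho>\<^sup>2"
      if "h \<noteq> 0" "dist h 0 < \<rho>" for h
      using rem[of h] that z by (simp add: field_simps power2_eq_square)
    show "((\<lambda>h. norm h * M / \<rho>\<^sup>2) \<longlongrightarrow> 0) (at 0)"
      by (auto intro!: tendsto_eq_intros simp: \<rho>(1)[THEN less_imp_neq, symmetric])
  qed simp
  ultimately have "(\<lambda>h. P h + (g h - P h)) differentiable at 0"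
    by (rule differentiable_add[OF _ differentiableI])
  then show ?thesis by simp
qed

text \<open>Pairing with \<open>i\<close> is bounded linear and passes through the sum. The
  resulting real coefficients are what the scalar power series lemmas take.\<close>

lemma real_analytic_at_component:
  assumes "real_analytic_at f p" 
  obtains a r where "r > 0"
    "\<And>h. norm h < r \<Longrightarrow> ((\<lambda>k. monomial_val k h * a k) has_sum (f (p + h) \<bullet> i)) multi_indices"
proof -
  obtain c r where "r > 0" and
    *: "\<And>h. norm h < r \<Longrightarrow> ((\<lambda>k. monomial_val k h *\<^sub>R c k) has_sum f (p + h)) multi_indices"
    using assms unfolding real_analytic_at_def by blast
  then show ?thesis
    using has_sum_bounded_linear[OF bounded_linear_inner_left[of i] *]
    by (intro that[of r "\<lambda>k. c k \<bullet> i"]) auto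
qed

lemma real_analytic_at_differentiable:
  assumes "real_analytic_at f p"
  shows "f differentiable at p"
proof -
  have "(\<lambda>x. f x \<bullet> i) differentiable at p" for i
  proof -
    obtain a r where "r > 0"
      "\<And>h. norm h < r \<Longrightarrow> ((\<lambda>k. monomial_val k h * a k) has_sum (f (p + h) \<bullet> i)) multi_indices"
      using real_analytic_at_component[OF assms] by metis
    then have "(\<lambda>h. f (p + h) \<bullet> i) differentiable at 0"
      by (rule power_series_differentiable)
    \<comment> \<open>The point 0 is written \<open>p - p\<close> to match the chain rule for the
      shift \<open>x - p\<close> at \<open>p\<close>.\<close>
    then obtain D where "((\<lambda>h. f (p + h) \<bullet> i) has_derivative D) (at (p - p))"
      by (auto simp: differentiable_def)
    moreover have "((\<lambda>x. x - p) has_derivative (\<lambda>x. x)) (at p)"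
      by (auto intro!: derivative_eq_intros)
    ultimately show ?thesis
      using has_derivative_compose[of "\<lambda>x. x - p" "\<lambda>x. x" p UNIV "\<lambda>h. f (p + h) \<bullet> i" D]
      by (auto simp: differentiable_def)
  qed
  then show ?thesis
    using differentiable_componentwise_within by blast
qed

text \<open>This extends a derivative in direction \<open>u\<close> along the line in direction
  \<open>v\<close>. Quantifying over \<open>D\<close> keeps differentiability out of the argument:
  whenever the derivative exists, \<open>H\<close> gives its value.\<close>

lemma power_series_directional_derivative:
  fixes a :: "('a::euclidean_space \<Rightarrow> nat) \<Rightarrow> real" and r :: real
  assumes "r > 0" and sum: "\<And>h. norm h < r \<Longrightarrow> ((\<lambda>k. monomial_val k h * a k) has_sum g h) multi_indices"
  shows "\<exists>\<delta>>0. \<exists>H. H holomorphic_on ball 0 \<delta> \<and>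
    (\<forall>t D. \<bar>t\<bar> < \<delta> \<longrightarrow> ((\<lambda>s. g (t *\<^sub>R v + s *\<^sub>R u)) has_real_derivative D) (at 0) \<longrightarrow>
       H (complex_of_real t) = complex_of_real D)"
proof -
  obtain \<rho> :: real where \<rho>: "\<rho> > 0" "\<rho> * DIM('a) < r"
    and summ: "(\<lambda>k. \<bar>a k\<bar> * \<rho> ^ (\<Sum>b\<in>Basis. k b)) summable_on multi_indices"
    by (rule power_series_abs_summable[OF assms])
  let ?deg = "\<lambda>k. \<Sum>b\<in>Basis. k (b::'a)"
  let ?F = "finite_subsets_at_top (multi_indices :: ('a \<Rightarrow> nat) set)"
  \<comment> \<open>With both parameters bounded by \<delta>, every coordinate of the complexified
    point stays within \<rho>; the summand 1 avoids a zero denominator when \<open>u\<close> and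
    \<open>v\<close> vanish.\<close>
  define \<delta> where "\<delta> = \<rho> / (norm v + norm u + 1)"
  have nn: "norm v + norm u + 1 > 0" by (simp add: add_nonneg_pos)
  have \<delta>: "\<delta> > 0" and \<delta>\<rho>: "\<delta> * (norm v + norm u) \<le> \<rho>"
    using \<rho>(1) nn by (auto simp: \<delta>_def field_simps)
  have lin: "norm (z * of_real x + w * of_real y) \<le> \<rho>"
    if "norm z \<le> \<delta>" "norm w \<le> \<delta>" "\<bar>x\<bar> \<le> norm v" "\<bar>y\<bar> \<le> norm u" for z w :: complex and x y
  proof -
    have "norm (z * of_real x + w * of_real y) \<le> norm z * \<bar>x\<bar> + norm w * \<bar>y\<bar>"
      by (metis norm_mult norm_of_real norm_triangle_ineq)
    also have "\<dots> \<le> \<delta> * norm v + \<delta> * norm u"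
      using that \<delta> by (intro add_mono mult_mono) auto
    finally show ?thesis using \<delta>\<rho> by (simp add: algebra_simps)
  qed
  \<comment> \<open>Complexify both parameters of \<open>t v + s u\<close>: \<open>m k\<close> is the monomial and \<open>m' k\<close> its
    derivative in the second parameter at 0. Cauchy's inequality bounds \<open>m' k\<close> by \<open>m k\<close>, so
    the differentiated series converges uniformly and its sum is holomorphic.\<close>
  define m where "m k z w = (\<Prod>b\<in>Basis. (z * of_real (v \<bullet> b) + w * of_real (u \<bullet> b)) ^ k b)"
    for k and z w :: complex
  \<comment> \<open>Product rule: for \<open>k b = 0\<close> the factor \<open>of_nat (k b)\<close>
    cancels the term, so the truncated exponent \<open>k b - 1\<close> is harmless.\<close>
  define m' where "m' k z = (\<Sum>b\<in>Basis. of_nat (k b) * of_real (u \<bullet> b) * (z * of_real (v \<bullet> b)) ^ (k b - 1) *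
      (\<Prod>b'\<in>Basis - {b}. (z * of_real (v \<bullet> b')) ^ k b'))" for k and z :: complex
  have m_bound: "norm (m k z w) \<le> \<rho> ^ ?deg k" if "norm z \<le> \<delta>" "norm w \<le> \<delta>" for k z w
    unfolding m_def power_sum prod_norm[symmetric] norm_power
    by (intro prod_mono conjI power_mono lin that Basis_le_norm) auto
  have m_hol: "m k z holomorphic_on S" for k z S
    unfolding m_def by (intro holomorphic_intros)
  have m'_hol: "m' k holomorphic_on S" for k S
    unfolding m'_def by (intro holomorphic_intros)
  have m_deriv: "(m k z has_field_derivative m' k z) (at 0)" for k z
    unfolding m_def[abs_def] m'_def
    by (rule has_field_derivative_prod[THEN DERIV_cong]) (auto intro!: derivative_eq_intros sum.cong)
  have m'_bound: "norm (m' k z) \<le> \<rho> ^ ?deg k / \<delta>" if "norm z \<le> \<delta>" for k z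
  proof -
    have "norm ((deriv ^^ 1) (m k z) 0) \<le> fact 1 * \<rho> ^ ?deg k / \<delta> ^ 1"
      using \<delta> that
      by (intro Cauchy_inequality m_hol holomorphic_on_imp_continuous_on m_bound) auto
    then show ?thesis using DERIV_imp_deriv[OF m_deriv] by simp
  qed
  define H where "H z = (\<Sum>\<^sub>\<infinity>k\<in>multi_indices. of_real (a k) * m' k z)" for z
  have ulimH: "uniform_limit (cball 0 \<delta>) (\<lambda>X z. \<Sum>k\<in>X. of_real (a k) * m' k z) H ?F"
    unfolding H_def
  proof (rule Weierstrass_m_test_general)
    show "norm (complex_of_real (a k) * m' k z) \<le> \<bar>a k\<bar> * \<rho> ^ ?deg k * (1 / \<delta>)"
      if "z \<in> cball 0 \<delta>" for k z
      using mult_left_mono[OF m'_bound[of z k], of "\<bar>a k\<bar>"] that by (simp add: norm_mult)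
  qed (intro summable_on_cmult_left summ)
  have "H holomorphic_on ball 0 \<delta>"
    by (rule holomorphic_uniform_limit[OF _ ulimH])
       (auto intro!: always_eventually holomorphic_intros holomorphic_on_imp_continuous_on m'_hol)
  moreover have "H (complex_of_real t) = complex_of_real D"
    if t: "\<bar>t\<bar> < \<delta>" and D: "((\<lambda>s. g (t *\<^sub>R v + s *\<^sub>R u)) has_real_derivative D) (at 0)" for t D
  proof -
    \<comment> \<open>To identify \<open>H\<close> with the true derivative, fix \<open>t\<close>
      and vary \<open>w\<close>: the uniform limit \<open>G\<close> may be differentiated termwise,
      giving \<open>H ?z\<close> at \<open>w = 0\<close>, and \<open>G\<close> agrees with
      \<open>g\<close> for real \<open>w\<close>.\<close>
    let ?z = "complex_of_real t"
    define G where "G w = (\<Sum>\<^sub>\<infinity>k\<in>multi_indices. of_real (a k) * m k ?z w)" for w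
    have ulimG: "uniform_limit (cball 0 \<delta>) (\<lambda>X w. \<Sum>k\<in>X. of_real (a k) * m k ?z w) G ?F"
      unfolding G_def
    proof (rule Weierstrass_m_test_general)
      show "norm (complex_of_real (a k) * m k ?z w) \<le> \<bar>a k\<bar> * \<rho> ^ ?deg k"
        if "w \<in> cball 0 \<delta>" for k w
        using mult_left_mono[OF m_bound[of ?z w k], of "\<bar>a k\<bar>"] that t by (simp add: norm_mult)
    qed (rule summ)
    obtain G' where G': "\<And>w. w \<in> ball 0 \<delta> \<Longrightarrow> (G has_field_derivative G' w) (at w) \<and>
        ((\<lambda>X. \<Sum>k\<in>X. of_real (a k) * deriv (m k ?z) w) \<longlongrightarrow> G' w) ?F"
    proof (rule has_complex_derivative_uniform_limit[OF _ ulimG _ \<delta>])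
      show "\<forall>\<^sub>F X in ?F. continuous_on (cball 0 \<delta>) (\<lambda>w. \<Sum>k\<in>X. of_real (a k) * m k ?z w) \<and>
          (\<forall>w\<in>ball 0 \<delta>. ((\<lambda>w. \<Sum>k\<in>X. of_real (a k) * m k ?z w) has_field_derivative
             (\<Sum>k\<in>X. of_real (a k) * deriv (m k ?z) w)) (at w))"
        by (intro always_eventually allI conjI ballI DERIV_sum DERIV_cmult
              holomorphic_derivI[OF m_hol open_UNIV] holomorphic_on_imp_continuous_on holomorphic_intros m_hol) auto
    qed auto
    have "((\<lambda>X. \<Sum>k\<in>X. of_real (a k) * m' k ?z) \<longlongrightarrow> H ?z) ?F"
      by (rule tendsto_uniform_limitI[OF ulimH]) (use t in auto)
    moreover have "((\<lambda>X. \<Sum>k\<in>X. of_real (a k) * m' k ?z) \<longlongrightarrow> G' 0) ?F"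
      using G'[of 0] \<delta> DERIV_imp_deriv[OF m_deriv] by simp
    ultimately have "G' 0 = H ?z"
      using tendsto_unique finite_subsets_at_top_neq_bot by blast
    with G'[of 0] \<delta> have "(G has_field_derivative H ?z) (at (of_real 0))" by simp
    from field_vector_diff_chain_at[OF has_vector_derivative_of_real[OF DERIV_ident] this]
    have GH: "((\<lambda>s. G (of_real s)) has_vector_derivative H ?z) (at 0)" by (simp add: o_def)
    have eq: "G (of_real s) = of_real (g (t *\<^sub>R v + s *\<^sub>R u))" if s: "\<bar>s\<bar> < \<delta>" for s
    proof -
      let ?h = "t *\<^sub>R v + s *\<^sub>R u"
      have "norm ?h \<le> \<bar>t\<bar> * norm v + \<bar>s\<bar> * norm u"
        by (metis norm_scaleR norm_triangle_ineq)
      also have "\<dots> \<le> \<delta> * norm v + \<delta> * norm u"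
        using s t by (intro add_mono mult_right_mono) auto
      also have "\<dots> \<le> \<rho>" using \<delta>\<rho> by (simp add: algebra_simps)
      also have "\<rho> \<le> \<rho> * DIM('a)" using \<rho>(1) DIM_positive[where 'a='a] by (simp add: Suc_leI)
      finally have "norm ?h < r" using \<rho>(2) by simp
      from has_sum_of_real[OF sum[OF this], where 'a = complex]
      have "((\<lambda>k. of_real (a k) * m k ?z (of_real s)) has_sum of_real (g ?h)) multi_indices"
        by (simp add: m_def monomial_val_def inner_add_left mult.commute)
      then show ?thesis unfolding G_def by (rule infsumI)
    qed
    \<comment> \<open>Now \<open>H ?z\<close> and \<open>D\<close> are both derivatives of the same
      complex-valued curve, hence equal.\<close>
    have "((\<lambda>s. complex_of_real (g (t *\<^sub>R v + s *\<^sub>R u))) has_vector_derivative H ?z) (at 0)"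
      by (rule has_vector_derivative_transform_within[OF GH \<delta>]) (simp_all add: eq)
    moreover have "((\<lambda>s. complex_of_real (g (t *\<^sub>R v + s *\<^sub>R u))) has_vector_derivative of_real D) (at 0)"
      by (rule has_vector_derivative_of_real[OF D])
    ultimately show ?thesis by (rule vector_derivative_unique_at)
  qed
  ultimately show ?thesis using \<delta> by blast
qed

subsection \<open>Directional derivatives and the Jacobian\<close>

text \<open>This reduces the Frechet derivative to a limit in one real parameter, the form used for
  both holomorphic extension and measurability.\<close>

lemma has_real_derivative_along:
  assumes "f differentiable at x"
  shows "((\<lambda>s. f (x + s *\<^sub>R u) \<bullet> i) has_real_derivative frechet_derivative f (at x) u \<bullet> i) (at 0)"
proof -
  let ?f' = "frechet_derivative f (at x)"
  have "(f has_derivative ?f') (at (x + 0 *\<^sub>R u))"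
    using assms by (simp add: frechet_derivative_works[symmetric])
  moreover have "((\<lambda>s. x + s *\<^sub>R u) has_derivative (\<lambda>s. s *\<^sub>R u)) (at 0)"
    by (auto intro!: derivative_eq_intros)
  ultimately have "((\<lambda>s. f (x + s *\<^sub>R u)) has_derivative (\<lambda>s. ?f' (s *\<^sub>R u))) (at 0)"
    by (rule has_derivative_compose[rotated])
  then have "((\<lambda>s. f (x + s *\<^sub>R u) \<bullet> i) has_derivative (\<lambda>s. ?f' (s *\<^sub>R u) \<bullet> i)) (at 0)"
    by (rule has_derivative_inner_left)
  moreover have "?f' (s *\<^sub>R u) \<bullet> i = (?f' u \<bullet> i) * s" for s
    using linear_frechet_derivative[OF assms] by (simp add: linear_cmul mult.commute)
  ultimately show ?thesis
    by (simp add: has_field_derivative_def)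
qed

lemma real_analytic_differentiable: "real_analytic f \<Longrightarrow> f differentiable at p"
  by (simp add: real_analytic_def real_analytic_at_differentiable)

text \<open>Near each \<open>t\<^sub>0\<close>, the power series of \<open>f\<close> about the point
  \<open>p\<close> of the line supplies the extension, shifted from centre 0 to
  \<open>t\<^sub>0\<close>.\<close>

lemma locally_holomorphic_directional_derivative:
  assumes "real_analytic f"
  shows "locally_holomorphic (\<lambda>t. frechet_derivative f (at (q + t *\<^sub>R v)) u \<bullet> i)"
  unfolding locally_holomorphic_def
proof
  fix t\<^sub>0
  define p where "p = q + t\<^sub>0 *\<^sub>R v"
  obtain a r where ser: "r > 0"
    "\<And>h. norm h < r \<Longrightarrow> ((\<lambda>k. monomial_val k h * a k) has_sum (f (p + h) \<bullet> i)) multi_indices"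
    using real_analytic_at_component assms unfolding real_analytic_def by metis
  obtain \<delta> H where \<delta>: "\<delta> > 0" and H: "H holomorphic_on ball 0 \<delta>"
    and HD: "\<forall>t D. \<bar>t\<bar> < \<delta> \<longrightarrow>
       ((\<lambda>s. f (p + (t *\<^sub>R v + s *\<^sub>R u)) \<bullet> i) has_real_derivative D) (at 0) \<longrightarrow>
       H (complex_of_real t) = complex_of_real D"
    using power_series_directional_derivative[OF ser, of v u] by blast
  have "(\<lambda>z. H (z - of_real t\<^sub>0)) holomorphic_on ball (of_real t\<^sub>0) \<delta>"
    by (rule holomorphic_on_compose_gen[OF _ H, unfolded o_def])
       (auto intro!: holomorphic_intros simp: dist_norm norm_minus_commute)
  moreover have "H (of_real t - of_real t\<^sub>0) = of_real (frechet_derivative f (at (q + t *\<^sub>R v)) u \<bullet> i)"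
    if "\<bar>t - t\<^sub>0\<bar> < \<delta>" for t
  proof -
    have "f differentiable at (q + t *\<^sub>R v)"
      by (rule real_analytic_differentiable[OF assms])
    from has_real_derivative_along[OF this, of u i]
    have "((\<lambda>s. f (p + ((t - t\<^sub>0) *\<^sub>R v + s *\<^sub>R u)) \<bullet> i) has_real_derivative
        frechet_derivative f (at (q + t *\<^sub>R v)) u \<bullet> i) (at 0)"
      by (simp add: p_def algebra_simps)
    with HD that have "H (of_real (t - t\<^sub>0)) = of_real (frechet_derivative f (at (q + t *\<^sub>R v)) u \<bullet> i)"
      by blast
    then show ?thesis by simp
  qed
  ultimately show "\<exists>r>0. \<exists>H. H holomorphic_on ball (of_real t\<^sub>0) r \<and>
     (\<forall>t. \<bar>t - t\<^sub>0\<bar> < r \<longrightarrow>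
        H (of_real t) = of_real (frechet_derivative f (at (q + t *\<^sub>R v)) u \<bullet> i))"
    using \<delta> by (intro exI[of _ \<delta>] conjI exI[of _ "\<lambda>z. H (z - of_real t\<^sub>0)"]) auto
qed

text \<open>The derivative is a pointwise limit of difference quotients with steps
  \<open>1 / (n + 1)\<close>, each measurable because \<open>f\<close> is continuous.\<close>

lemma borel_measurable_frechet_derivative:
  fixes f :: "'a::euclidean_space \<Rightarrow> 'b::euclidean_space"
  assumes "\<And>x. f differentiable at x"
  shows "(\<lambda>x. frechet_derivative f (at x) u \<bullet> i) \<in> borel_measurable borel"
proof (rule borel_measurable_LIMSEQ_real)
  let ?e = "\<lambda>n. 1 / real (Suc n)"
  have e: "filterlim ?e (at 0) sequentially"
    unfolding filterlim_at using LIMSEQ_Suc[OF lim_1_over_n[where 'a = real]] by auto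
  show "(\<lambda>n. (f (x + ?e n *\<^sub>R u) \<bullet> i - f x \<bullet> i) / ?e n) \<longlonglongrightarrow> frechet_derivative f (at x) u \<bullet> i" for x
    using filterlim_compose[OF _ e] has_real_derivative_along[OF assms, of x u i]
    by (fastforce simp: DERIV_def)
  have "continuous_on UNIV f"
    using assms differentiable_imp_continuous_within continuous_at_imp_continuous_on by blast
  then have [measurable]: "f \<in> borel_measurable borel"
    by (rule borel_measurable_continuous_onI)
  show "(\<lambda>x. (f (x + ?e n *\<^sub>R u) \<bullet> i - f x \<bullet> i) / ?e n) \<in> borel_measurable borel" for n
    by measurable
qed

text \<open>Written through the joint derivative in directions \<open>(axis j 1, 0)\<close>, so that
  one matrix function on the product space serves either choice of free variable.\<close>

definition partial_jacobian :: "((real ^ 'm) \<times> (real ^ 'n) \<Rightarrow> real ^ 'm) \<Rightarrow> (real ^ 'm) \<times> (real ^ 'n) \<Rightarrow> real ^ 'm ^ 'm"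
  where "partial_jacobian f p = (\<chi> i j. frechet_derivative f (at p) (axis j 1, 0) \<bullet> axis i 1)"

text \<open>The two scalars \<open>a\<close> and \<open>b\<close> cover both families of maps in the
  theorem.\<close>

lemma jacobian_eq_partial_jacobian:
  fixes f :: "(real ^ 'm) \<times> (real ^ 'n) \<Rightarrow> real ^ 'm"
  assumes "f differentiable at (x, y)"
  shows "jacobian (\<lambda>x. a *\<^sub>R x + b *\<^sub>R f (x, y)) (at x) = mat a + b *\<^sub>R partial_jacobian f (x, y)"
proof -
  let ?f' = "frechet_derivative f (at (x, y))"
  have "(f has_derivative ?f') (at (x, y))"
    using assms by (simp add: frechet_derivative_works[symmetric])
  moreover have "((\<lambda>x. (x, y)) has_derivative (\<lambda>h. (h, 0))) (at x)"
    by (auto intro!: derivative_eq_intros)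
  ultimately have "((\<lambda>x. f (x, y)) has_derivative (\<lambda>h. ?f' (h, 0))) (at x)"
    by (rule has_derivative_compose[rotated])
  then have "((\<lambda>x. a *\<^sub>R x + b *\<^sub>R f (x, y)) has_derivative (\<lambda>h. a *\<^sub>R h + b *\<^sub>R ?f' (h, 0))) (at x)"
    by (auto intro!: derivative_eq_intros)
  moreover have "axis j 1 $ i = (if i = j then 1 else 0 :: real)" for i j :: 'm
    by (simp add: axis_def)
  ultimately show ?thesis
    by (simp add: jacobian_def matrix_def partial_jacobian_def vec_eq_iff mat_def inner_axis
        flip: frechet_derivative_at)
qed

text \<open>The affine map \<phi> inserts the free variable and sends lines to lines with direction
  given by \<psi>. On each line through \<open>p\<close> the determinant is analytic and nonzero at
  \<open>t = 0\<close>, so its zeros there are countable.\<close>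

lemma null_sets_det_partial_jacobian:
  fixes \<phi> :: "'c::euclidean_space \<Rightarrow> (real ^ 'm) \<times> (real ^ 'n)"
  assumes f: "real_analytic f"
    and \<phi>: "\<And>x t v. \<phi> (x + t *\<^sub>R v) = \<phi> x + t *\<^sub>R \<psi> v" "\<phi> \<in> borel_measurable borel"
    and p: "det (mat \<alpha> + partial_jacobian f (\<phi> p)) \<noteq> 0"
  shows "{z. det (mat \<alpha> + partial_jacobian f (\<phi> z)) = 0} \<in> null_sets lebesgue" (is "?Z \<in> _")
proof (rule null_sets_if_null_on_lines)
  have diff: "f differentiable at x" for x
    by (rule real_analytic_differentiable[OF f])
  have [measurable]: "(\<lambda>z. partial_jacobian f (\<phi> z) $ i $ j) \<in> borel_measurable borel" for i j
    unfolding partial_jacobian_def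
    using measurable_compose[OF \<phi>(2) borel_measurable_frechet_derivative[OF diff]] by simp
  show "?Z \<in> sets borel"
    unfolding det_def vector_add_component by measurable
  show "{t. p + t *\<^sub>R v \<in> ?Z} \<in> null_sets lborel" for v
  proof -
    have "locally_holomorphic (\<lambda>t. det (mat \<alpha> + partial_jacobian f (\<phi> p + t *\<^sub>R \<psi> v)))"
      unfolding partial_jacobian_def
      by (rule locally_holomorphic_det)
         (simp add: locally_holomorphic_add locally_holomorphic_const locally_holomorphic_directional_derivative[OF f])
    then have "countable {t. det (mat \<alpha> + partial_jacobian f (\<phi> p + t *\<^sub>R \<psi> v)) = 0}"
      by (rule locally_holomorphic_countable_zeros[where a = 0]) (use p in simp)
    then show ?thesis
      by (simp add: \<phi>(1) countable_imp_null_set_lborel)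
  qed
qed

lemma full_rank_jacobian_almost_everywhere:
  fixes \<phi> :: "'c::euclidean_space \<Rightarrow> (real ^ 'm) \<times> (real ^ 'n)"
  assumes f: "real_analytic f"
    and \<phi>: "\<And>x t v. \<phi> (x + t *\<^sub>R v) = \<phi> x + t *\<^sub>R \<psi> v" "\<phi> \<in> borel_measurable borel"
  shows "\<exists>E. finite E \<and>
    (\<forall>\<alpha>. \<alpha> \<notin> E \<longrightarrow>
      {z. \<not> full_rank (jacobian (\<lambda>x. \<alpha> *\<^sub>R x + f (x, snd (\<phi> z))) (at (fst (\<phi> z))))} \<in> null_sets lebesgue) \<and>
    (\<forall>\<eta>. \<eta> \<notin> reciprocals E \<union> {0} \<longrightarrow>
      {z. \<not> full_rank (jacobian (\<lambda>x. x + \<eta> *\<^sub>R f (x, snd (\<phi> z))) (at (fst (\<phi> z))))} \<in> null_sets lebesgue)"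
proof (intro exI conjI allI impI)
  let ?J = "\<lambda>z. partial_jacobian f (\<phi> z)"
  \<comment> \<open>The exceptional values are read off at the single point 0: a nonzero determinant
    there already makes the zero set null.\<close>
  let ?E = "{\<alpha>. det (mat \<alpha> + ?J 0) = 0}"
  have diff: "f differentiable at x" for x
    by (rule real_analytic_differentiable[OF f])
  show "finite ?E" by (rule finite_det_mat_add_eq_0)
  have jac: "jacobian (\<lambda>x. a *\<^sub>R x + b *\<^sub>R f (x, snd (\<phi> z))) (at (fst (\<phi> z))) = mat a + b *\<^sub>R ?J z" for a b z
    using jacobian_eq_partial_jacobian[of f "fst (\<phi> z)" "snd (\<phi> z)"] diff by simp
  have null: "{z. \<not> full_rank (mat \<alpha> + ?J z)} \<in> null_sets lebesgue" if "\<alpha> \<notin> ?E" for \<alpha>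
    using null_sets_det_partial_jacobian[OF f \<phi>, of \<alpha> 0] that by (simp add: full_rank_iff_det)
  show "{z. \<not> full_rank (jacobian (\<lambda>x. \<alpha> *\<^sub>R x + f (x, snd (\<phi> z))) (at (fst (\<phi> z))))} \<in> null_sets lebesgue"
    if "\<alpha> \<notin> ?E" for \<alpha>
    using null[OF that] jac[of \<alpha> 1] by simp
  show "{z. \<not> full_rank (jacobian (\<lambda>x. x + \<eta> *\<^sub>R f (x, snd (\<phi> z))) (at (fst (\<phi> z))))} \<in> null_sets lebesgue"
    if \<eta>: "\<eta> \<notin> reciprocals ?E \<union> {0}" for \<eta>
  proof -
    have "1 / \<eta> \<notin> ?E"
    proof
      assume "1 / \<eta> \<in> ?E"
      with \<eta> have "1 / (1 / \<eta>) \<in> reciprocals ?E"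
        unfolding reciprocals_def by (intro CollectI exI[of _ "1 / \<eta>"]) simp
      with \<eta> show False by simp
    qed
    \<comment> \<open>Factoring out the nonzero \<eta> reduces the second family to the first at
      \<open>1 / \<eta>\<close>.\<close>
    moreover have "mat 1 + \<eta> *\<^sub>R ?J z = \<eta> *\<^sub>R (mat (1 / \<eta>) + ?J z)" for z
      using \<eta> by (simp add: vec_eq_iff mat_def algebra_simps)
    ultimately show ?thesis
      using null[of "1 / \<eta>"] jac[of 1 \<eta>] \<eta> by (simp add: full_rank_scaleR)
  qed
qed

theorem lemma8:
  fixes f :: "(real ^ 'm) \<times> (real ^ 'n) \<Rightarrow> real ^ 'm"
    and x\<^sub>0 :: "real ^ 'm" and y\<^sub>0 :: "real ^ 'n"
  assumes "real_analytic f"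
  shows "(\<exists>E. finite E \<and>
            (\<forall>\<alpha>. \<alpha> \<notin> E \<longrightarrow>
              {x. \<not> full_rank (jacobian (\<lambda>x. \<alpha> *\<^sub>R x + f (x, y\<^sub>0)) (at x))} \<in> null_sets lebesgue) \<and>
            (\<forall>\<eta>. \<eta> \<notin> reciprocals E \<union> {0} \<longrightarrow>
              {x. \<not> full_rank (jacobian (\<lambda>x. x + \<eta> *\<^sub>R f (x, y\<^sub>0)) (at x))} \<in> null_sets lebesgue))
       \<and> (\<exists>E. finite E \<and>
            (\<forall>\<alpha>. \<alpha> \<notin> E \<longrightarrow>
              {y. \<not> full_rank (jacobian (\<lambda>x. \<alpha> *\<^sub>R x + f (x, y)) (at x\<^sub>0))} \<in> null_sets lebesgue) \<and>
            (\<forall>\<eta>. \<eta> \<notin> reciprocals E \<union> {0} \<longrightarrow>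
              {y. \<not> full_rank (jacobian (\<lambda>x. x + \<eta> *\<^sub>R f (x, y)) (at x\<^sub>0))} \<in> null_sets lebesgue))"
proof
  have "(\<lambda>x. (x, y\<^sub>0)) \<in> borel_measurable borel" "(\<lambda>y. (x\<^sub>0, y)) \<in> borel_measurable borel"
    by (auto intro!: borel_measurable_continuous_onI continuous_intros)
  \<comment> \<open>The direction map \<psi> fills the slot of the free variable and puts 0 in the
    fixed one.\<close>
  note * = full_rank_jacobian_almost_everywhere[OF assms _ this(1), of "\<lambda>v. (v, 0)"]
    full_rank_jacobian_almost_everywhere[OF assms _ this(2), of "\<lambda>v. (0, v)"]
  show "\<exists>E. finite E \<and>
            (\<forall>\<alpha>. \<alpha> \<notin> E \<longrightarrow>
              {x. \<not> full_rank (jacobian (\<lambda>x. \<alpha> *\<^sub>R x + f (x, y\<^sub>0)) (at x))} \<in> null_sets lebesgue) \<and>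
            (\<forall>\<eta>. \<eta> \<notin> reciprocals E \<union> {0} \<longrightarrow>
              {x. \<not> full_rank (jacobian (\<lambda>x. x + \<eta> *\<^sub>R f (x, y\<^sub>0)) (at x))} \<in> null_sets lebesgue)"
    using *(1) by simp
  show "\<exists>E. finite E \<and>
            (\<forall>\<alpha>. \<alpha> \<notin> E \<longrightarrow>
              {y. \<not> full_rank (jacobian (\<lambda>x. \<alpha> *\<^sub>R x + f (x, y)) (at x\<^sub>0))} \<in> null_sets lebesgue) \<and>
            (\<forall>\<eta>. \<eta> \<notin> reciprocals E \<union> {0} \<longrightarrow>
              {y. \<not> full_rank (jacobian (\<lambda>x. x + \<eta> *\<^sub>R f (x, y)) (at x\<^sub>0))} \<in> null_sets lebesgue)"
    using *(2) by simp
qed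

end
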